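(* Consider belief-propagation decoding, with prior side information, of an LT code with $k$ message bits over the binary-input AWGN channel, under the all-zero message convention (code, priors, channel, messages and expectation as described in the context). For non-trivial values of the prior log-likelihood ratios $\mu_1,\dots,\mu_k$, i.e. with $|\mu_i|>0$ for $i=1,2,\dots,k$, there is always $$\mathbb{E}\left[m_{i,o}^{(1)}\right] > \mathbb{E}\left[m_{i,o}^{(0)}\right],$$ that is, the mean of the messages passed from input nodes to output nodes increases in the first iteration.
   Context: LT code. There are $k$ message bits $b_1,\dots,b_k$ (input nodes), assumed independent. Coded symbols (output nodes) are generated in an i.i.d. manner: a degree $d\in\{1,\dots,k\}$ is drawn from a degree distribution $\Omega(d)$, and then a subset $S_d$ of $d$ input nodes is selected with probability $p(S_d)=\prod_{j\in S_d}\rho_j\big/\sum_{|S_d|=d}\prod_{j\in S_d}\rho_j$, where $\rho_j\in[0,1]$ is the selection probability of message bit $j$; the coded symbol is the XOR of the selected bits. Output node $o$ and input node $i$ are adjacent when bit $i$ is among those selected for $o$. The output edge degree distribution $\omega(d)$ is the probability that an edge is attached to an output node of degree $d$, and the input edge degree distribution $\iota(d)$ is the probability that an edge is attached to an input node of degree $d$. Priors. The decoder has for each bit a prior log-likelihood ratio $\mu_i$, assumed to reflect the true bit statistics: $\mu_i=\ln\frac{p(b_i=0)}{p(b_i=1)}$, the probabilities being conditional on the source. To work under the all-zero message convention, define the flipped prior $\tilde\mu_i=\mu_i$ if $b_i=0$ and $\tilde\mu_i=-\mu_i$ if $b_i=1$. Hence, given $\mu_i$, $\tilde\mu_i=|\mu_i|$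 with probability $\mathrm{sigmoid}(|\mu_i|)$ and $\tilde\mu_i=-|\mu_i|$ with probability $1-\mathrm{sigmoid}(|\mu_i|)$, where $\mathrm{sigmoid}(x)=1/(1+e^{-x})$. Channel. Under the all-zero convention, the demodulator output log-likelihood ratio $\hat v_o$ of an output node $o$ is Gaussian with mean $s^2/2$ and variance $s^2$, for a parameter $s^2>0$; the channel noise is i.i.d. across coded symbols. Messages. $m_{i,o}^{(l)}$ is the message from input node $i$ to output node $o$, and $m_{o,i}^{(l)}$ the message from output node $o$ to input node $i$, in round $l$. The initial message is $m_{i,o}^{(0)}=\tilde\mu_i$, and the update rules are $$\tanh\left(m_{o,i}^{(l)}/2\right)=\tanh\left(\hat v_o/2\right)\prod_{i'\ne i}\tanh\left(m_{i',o}^{(l)}/2\right),\qquad m_{i,o}^{(l+1)}=\tilde\mu_i+\sum_{o'\neq o}m_{o',i}^{(l)},$$ where the product is over all input nodes adjacent to $o$ other than $i$ and the sum is over all output nodes adjacent to $i$ other than $o$. Expectation. $\mathbb{E}$ denotes the average over the channel outputs $\hat v_o$, the flipped priors $\tilde\mu_1,\dots,\tilde\mu_k$ (given $\mu_1,\dots,\mu_k$), and the random code graph, i.e. the edge degrees (distributed as $\omega$ on the output side and $\iota$ on the input side) and the selected subsets $S_d$.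
   Formalization: The formal theorem assumes at least two coded symbols (output nodes): with a single one, no input node has another neighbour, so the first-round message equals the initial one and the strict inequality fails. *)

theory Defs
  imports "HOL-Probability.Probability"
begin

section \<open>LT code ensemble\<close>

text \<open>Input nodes are \<open>{1..k}\<close>, output nodes are \<open>{1..n}\<close>. A code graph is a function
  \<open>S\<close> mapping an output node \<open>c\<close> to the set \<open>S c\<close> of message bits selected for it.\<close>

definition subset_norm :: "nat \<Rightarrow> (nat \<Rightarrow> real) \<Rightarrow> nat \<Rightarrow> real" where
  "subset_norm k \<rho> d = (\<Sum>T | T \<subseteq> {1..k} \<and> card T = d. \<Prod>j\<in>T. \<rho> j)"

text \<open>Meaningful only if the normalising sum is positive; see \<open>pmf_subset_pmf\<close>.\<close>

definition subset_pmf :: "nat \<Rightarrow> (nat \<Rightarrow> real) \<Rightarrow> nat \<Rightarrow> nat set pmf" where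
  "subset_pmf k \<rho> d = embed_pmf (\<lambda>T.
     if T \<subseteq> {1..k} \<and> card T = d then (\<Prod>j\<in>T. \<rho> j) / subset_norm k \<rho> d else 0)"

lemma pmf_subset_pmf:
  assumes "\<And>j. j \<in> {1..k} \<Longrightarrow> 0 \<le> \<rho> j" and "subset_norm k \<rho> d > 0"
  shows "pmf (subset_pmf k \<rho> d) T =
    (if T \<subseteq> {1..k} \<and> card T = d then (\<Prod>j\<in>T. \<rho> j) / subset_norm k \<rho> d else 0)"
proof -
  let ?A = "{T. T \<subseteq> {1..k} \<and> card T = d}"
  let ?f = "\<lambda>T. if T \<in> ?A then (\<Prod>j\<in>T. \<rho> j) / subset_norm k \<rho> d else 0"
  have fin: "finite ?A" by (rule finite_subset[of _ "Pow {1..k}"]) auto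
  have nonneg: "0 \<le> ?f T" for T
    using assms by (auto intro!: divide_nonneg_pos prod_nonneg)
  have "(\<integral>\<^sup>+ T. ennreal (?f T) \<partial>count_space UNIV) = (\<Sum>T\<in>?A. ennreal (?f T))"
    by (rule nn_integral_count_space'[OF fin]) auto
  also have "\<dots> = ennreal (\<Sum>T\<in>?A. ?f T)"
    using nonneg by (intro sum_ennreal) blast
  also have "(\<Sum>T\<in>?A. ?f T) = 1"
    using assms(2) by (simp add: sum_divide_distrib[symmetric] subset_norm_def)
  finally have "(\<integral>\<^sup>+ T. ennreal (?f T) \<partial>count_space UNIV) = 1" by simp
  then have "pmf (embed_pmf ?f) T = ?f T"
    using nonneg by (intro pmf_embed_pmf)
  then show ?thesis by (simp add: subset_pmf_def)
qed

definition code_pmf :: "nat \<Rightarrow> nat \<Rightarrow> nat pmf \<Rightarrow> (nat \<Rightarrow> real) \<Rightarrow> (nat \<Rightarrow> nat set) pmf" where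
  "code_pmf k n \<Omega> \<rho> = Pi_pmf {1..n} {} (\<lambda>_. bind_pmf \<Omega> (subset_pmf k \<rho>))"

section \<open>Flipped priors\<close>

definition sigmoid :: "real \<Rightarrow> real" where
  "sigmoid x = 1 / (1 + exp (- x))"

definition flipped_prior_pmf :: "real \<Rightarrow> real pmf" where
  "flipped_prior_pmf x =
     map_pmf (\<lambda>keep. if keep then \<bar>x\<bar> else - \<bar>x\<bar>) (bernoulli_pmf (sigmoid \<bar>x\<bar>))"

text \<open>This is the law of the prior flipped by the true bit (\<open>True\<close> standing for bit value 1),
  when \<open>x\<close> is the log-likelihood ratio of the bit.\<close>

lemma flipped_prior_pmf_eq_flip:
  assumes pos: "pmf B False > 0" "pmf B True > 0"
    and x: "x = ln (pmf B False / pmf B True)"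
  shows "map_pmf (\<lambda>b. if b then - x else x) B = flipped_prior_pmf x"
proof -
  define p where "p = pmf B True"
  have p: "pmf B True = p" "pmf B False = 1 - p" "0 < p" "p < 1"
    using pos pmf_False_conv_True[of B] by (simp_all add: p_def)
  have sigmoid_x: "sigmoid x = 1 - p"
  proof -
    have "exp (- x) = p / (1 - p)"
      using p x by (simp add: exp_minus)
    then have "1 + exp (- x) = 1 / (1 - p)"
      using p by (simp add: field_simps)
    then show ?thesis by (simp add: sigmoid_def)
  qed
  have sigmoid_minus_x: "sigmoid (- x) = p"
  proof -
    have "exp x = (1 - p) / p"
      using p x by simp
    then have "1 + exp x = 1 / p"
      using p by (simp add: field_simps)
    then show ?thesis by (simp add: sigmoid_def)
  qed
  have B: "B = bernoulli_pmf p"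
  proof (rule pmf_eqI)
    fix b show "pmf B b = pmf (bernoulli_pmf p) b"
      using p by (cases b) auto
  qed
  have not_B: "bernoulli_pmf p = map_pmf Not (bernoulli_pmf (1 - p))"
  proof (rule pmf_eqI)
    fix b
    have "pmf (map_pmf Not (bernoulli_pmf (1 - p))) (\<not> (\<not> b)) = pmf (bernoulli_pmf (1 - p)) (\<not> b)"
      by (rule pmf_map_inj') (auto simp: inj_def)
    then show "pmf (bernoulli_pmf p) b = pmf (map_pmf Not (bernoulli_pmf (1 - p))) b"
      using p by (cases b) auto
  qed
  show ?thesis
  proof (cases "x \<ge> 0")
    case True
    have "map_pmf (\<lambda>b. if b then - x else x) B =
        map_pmf (\<lambda>keep. if keep then x else - x) (bernoulli_pmf (1 - p))"
      unfolding B not_B map_pmf_comp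
      by (rule map_pmf_cong) auto
    also have "\<dots> = flipped_prior_pmf x"
      unfolding flipped_prior_pmf_def abs_of_nonneg[OF True] sigmoid_x ..
    finally show ?thesis .
  next
    case False
    then have "\<bar>x\<bar> = - x" by simp
    show ?thesis
      unfolding flipped_prior_pmf_def \<open>\<bar>x\<bar> = - x\<close> sigmoid_minus_x B minus_minus ..
  qed
qed

section \<open>Probability space\<close>

text \<open>An outcome \<open>(S, m, v)\<close> consists of the code graph, the flipped priors and the demodulator
  outputs. The parameter \<open>s\<close> is the standard deviation of the latter.\<close>

type_synonym outcome = "(nat \<Rightarrow> nat set) \<times> (nat \<Rightarrow> real) \<times> (nat \<Rightarrow> real)"

definition lt_space :: "nat \<Rightarrow> nat \<Rightarrow> nat pmf \<Rightarrow> (nat \<Rightarrow> real) \<Rightarrow> (nat \<Rightarrow> real) \<Rightarrow> real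
    \<Rightarrow> outcome measure" where
  "lt_space k n \<Omega> \<rho> \<mu> s =
     measure_pmf (code_pmf k n \<Omega> \<rho>) \<Otimes>\<^sub>M
     (measure_pmf (Pi_pmf {1..k} 0 (\<lambda>i. flipped_prior_pmf (\<mu> i))) \<Otimes>\<^sub>M
      (\<Pi>\<^sub>M c\<in>{1..n}. density lborel (normal_density (s\<^sup>2 / 2) s)))"

section \<open>Belief propagation\<close>

definition output_update ::
  "nat \<Rightarrow> outcome \<Rightarrow> (nat \<Rightarrow> nat \<Rightarrow> real) \<Rightarrow> nat \<Rightarrow> nat \<Rightarrow> real" where
  "output_update k = (\<lambda>(S, m, v) msg c i.
     2 * artanh (tanh (v c / 2) *
       (\<Prod>i' | i' \<in> {1..k} \<and> i' \<in> S c \<and> i' \<noteq> i. tanh (msg i' c / 2))))"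

definition input_update ::
  "nat \<Rightarrow> outcome \<Rightarrow> (nat \<Rightarrow> nat \<Rightarrow> real) \<Rightarrow> nat \<Rightarrow> nat \<Rightarrow> real" where
  "input_update n = (\<lambda>(S, m, v) msg i c.
     m i + (\<Sum>c' | c' \<in> {1..n} \<and> i \<in> S c' \<and> c' \<noteq> c. msg c' i))"

text \<open>\<open>input_msg k n x l i c\<close> is the message from input node \<open>i\<close> to output node \<open>c\<close> in round \<open>l\<close>,
  \<open>output_msg k n x l c i\<close> the message in the opposite direction.\<close>

primrec input_msg :: "nat \<Rightarrow> nat \<Rightarrow> outcome \<Rightarrow> nat \<Rightarrow> nat \<Rightarrow> nat \<Rightarrow> real" where
  "input_msg k n x 0 = (\<lambda>i c. fst (snd x) i)"
| "input_msg k n x (Suc l) = input_update n x (output_update k x (input_msg k n x l))"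

definition output_msg :: "nat \<Rightarrow> nat \<Rightarrow> outcome \<Rightarrow> nat \<Rightarrow> nat \<Rightarrow> nat \<Rightarrow> real" where
  "output_msg k n x l = output_update k x (input_msg k n x l)"

lemma tanh_artanh_real:
  fixes y :: real
  assumes "\<bar>y\<bar> < 1"
  shows "tanh (artanh y) = y"
proof -
  have "exp (- (2 * artanh y)) = (1 - y) / (1 + y)"
    using assms by (simp add: artanh_def exp_minus abs_less_iff)
  then have "tanh (artanh y) = (1 - (1 - y) / (1 + y)) / (1 + (1 - y) / (1 + y))"
    by (simp add: tanh_real_altdef)
  also have "\<dots> = y"
    using assms by (simp add: abs_less_iff divide_simps)
  finally show ?thesis .
qed

lemma input_msg_rule:
  "input_msg k n (S, m, v) (Suc l) i c =
     m i + (\<Sum>c' | c' \<in> {1..n} \<and> i \<in> S c' \<and> c' \<noteq> c. output_msg k n (S, m, v) l c' i)"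
  by (simp add: input_update_def output_msg_def)

lemma output_msg_rule:
  "tanh (output_msg k n (S, m, v) l c i / 2) =
     tanh (v c / 2) *
     (\<Prod>i' | i' \<in> {1..k} \<and> i' \<in> S c \<and> i' \<noteq> i. tanh (input_msg k n (S, m, v) l i' c / 2))"
    (is "_ = ?t * ?p")
proof -
  have tanh_less: "\<bar>tanh z\<bar> < 1" for z :: real
    using tanh_real_lt_1[of z] tanh_real_gt_neg1[of z] by linarith
  have "\<bar>?p\<bar> \<le> 1"
    unfolding abs_prod by (intro prod_le_1 conjI abs_ge_zero less_imp_le[OF tanh_less])
  then have "\<bar>?t\<bar> * \<bar>?p\<bar> \<le> \<bar>?t\<bar>"
    by (rule mult_left_le) (rule abs_ge_zero)
  also have "\<dots> < 1" by (rule tanh_less)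
  finally have "tanh (artanh (?t * ?p)) = ?t * ?p"
    by (intro tanh_artanh_real) (simp only: abs_mult)
  then show ?thesis
    by (simp add: output_msg_def output_update_def)
qed

section \<open>Averages over edges\<close>

definition edges :: "nat \<Rightarrow> nat \<Rightarrow> (nat \<Rightarrow> nat set) \<Rightarrow> (nat \<times> nat) set" where
  "edges k n S = {(i, c). i \<in> {1..k} \<and> c \<in> {1..n} \<and> i \<in> S c}"

definition input_degree :: "nat \<Rightarrow> outcome \<Rightarrow> nat \<Rightarrow> nat" where
  "input_degree n x i = card {c \<in> {1..n}. i \<in> fst x c}"

definition output_degree :: "nat \<Rightarrow> outcome \<Rightarrow> nat \<Rightarrow> nat" where
  "output_degree k x c = card {i \<in> {1..k}. i \<in> fst x c}"

text \<open>The mean of a quantity \<open>X x i c\<close> attached to the edges \<open>(i, c)\<close>, for a random edge of the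
  random graph: expected total over all edges, relative to the expected number of edges.\<close>

definition edge_mean :: "nat \<Rightarrow> nat \<Rightarrow> outcome measure \<Rightarrow> (outcome \<Rightarrow> nat \<Rightarrow> nat \<Rightarrow> real) \<Rightarrow> real" where
  "edge_mean k n M X =
     (\<integral>x. (\<Sum>(i, c)\<in>edges k n (fst x). X x i c) \<partial>M) / (\<integral>x. real (card (edges k n (fst x))) \<partial>M)"

text \<open>The edge degree distributions \<open>\<iota>\<close> and \<open>\<omega>\<close>. By the two lemmas after them,
  \<open>edge_mean\<close> averages over edge degrees with exactly these distributions.\<close>

definition input_edge_degree :: "nat \<Rightarrow> nat \<Rightarrow> outcome measure \<Rightarrow> nat \<Rightarrow> real" where
  "input_edge_degree k n M d = edge_mean k n M (\<lambda>x i c. of_bool (input_degree n x i = d))"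

definition output_edge_degree :: "nat \<Rightarrow> nat \<Rightarrow> outcome measure \<Rightarrow> nat \<Rightarrow> real" where
  "output_edge_degree k n M d = edge_mean k n M (\<lambda>x i c. of_bool (output_degree k x c = d))"

text \<open>The mean for a fixed pair of nodes, conditional on their being adjacent.\<close>

definition mean_given_edge ::
  "outcome measure \<Rightarrow> (outcome \<Rightarrow> nat \<Rightarrow> nat \<Rightarrow> real) \<Rightarrow> nat \<Rightarrow> nat \<Rightarrow> real" where
  "mean_given_edge M X i c =
     (\<integral>x. of_bool (i \<in> fst x c) * X x i c \<partial>M) / measure M {x \<in> space M. i \<in> fst x c}"

lemma finite_edges [simp]: "finite (edges k n S)"
  by (rule finite_subset[of _ "{1..k} \<times> {1..n}"]) (auto simp: edges_def)

lemma sum_edges: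
  "(\<Sum>(i, c)\<in>edges k n S. g i c) =
     (\<Sum>i\<in>{1..k}. \<Sum>c\<in>{1..n}. if i \<in> S c then g i c else (0 :: real))"
proof -
  have "edges k n S = {p \<in> {1..k} \<times> {1..n}. fst p \<in> S (snd p)}"
    by (auto simp: edges_def)
  then have "(\<Sum>(i, c)\<in>edges k n S. g i c) =
      (\<Sum>p\<in>{1..k} \<times> {1..n}. if fst p \<in> S (snd p) then case p of (i, c) \<Rightarrow> g i c else 0)"
    by (simp add: sum.inter_filter)
  also have "\<dots> = (\<Sum>i\<in>{1..k}. \<Sum>c\<in>{1..n}. if i \<in> S c then g i c else 0)"
    by (simp only: sum.cartesian_product case_prod_unfold)
  finally show ?thesis .
qed

lemma prob_space_lt_space:
  assumes "s > 0"
  shows "prob_space (lt_space k n \<Omega> \<rho> \<mu> s)"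
proof -
  interpret N: prob_space "density lborel (normal_density (s\<^sup>2 / 2) s)"
    using assms by (rule prob_space_normal_density)
  interpret P: product_prob_space "\<lambda>_::nat. density lborel (normal_density (s\<^sup>2 / 2) s)" "{1..n}"
    by unfold_locales
  show ?thesis
    unfolding lt_space_def
    by (intro prob_space_pair measure_pmf.prob_space_axioms P.prob_space_axioms)
qed

lemma integrable_graph:
  fixes f :: "(nat \<Rightarrow> nat set) \<Rightarrow> real"
  assumes "s > 0" and "\<And>S. \<bar>f S\<bar> \<le> C"
  shows "integrable (lt_space k n \<Omega> \<rho> \<mu> s) (\<lambda>x. f (fst x))"
proof -
  interpret prob_space "lt_space k n \<Omega> \<rho> \<mu> s"
    using assms(1) by (rule prob_space_lt_space)
  have "(\<lambda>x. f (fst x)) \<in> borel_measurable (lt_space k n \<Omega> \<rho> \<mu> s)"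
    unfolding lt_space_def
    by (rule measurable_compose[OF measurable_fst]) simp
  then show ?thesis
    using assms(2) by (intro integrable_const_bound[where B = C]) auto
qed

lemma edge_mean_degree:
  fixes deg :: "(nat \<Rightarrow> nat set) \<Rightarrow> nat \<Rightarrow> nat \<Rightarrow> nat" and g \<rho> \<mu> :: "nat \<Rightarrow> real"
    and k n :: nat and \<Omega> :: "nat pmf"
  assumes "s > 0" and deg: "\<And>S i c. deg S i c \<le> N"
  defines "M \<equiv> lt_space k n \<Omega> \<rho> \<mu> s"
  shows "edge_mean k n M (\<lambda>x i c. g (deg (fst x) i c)) =
    (\<Sum>d\<le>N. g d * edge_mean k n M (\<lambda>x i c. of_bool (deg (fst x) i c = d)))"
proof -
  let ?h = "\<lambda>d S. \<Sum>(i, c)\<in>edges k n S. of_bool (deg S i c = d) :: real"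
  have int: "integrable M (\<lambda>x. ?h d (fst x))" for d
    unfolding M_def
  proof (rule integrable_graph[OF \<open>s > 0\<close>])
    fix S
    have "\<bar>?h d S\<bar> \<le> (\<Sum>p\<in>edges k n S. 1)"
      by (rule order_trans[OF sum_abs sum_mono]) auto
    also have "\<dots> \<le> real (card ({1..k} \<times> {1..n}))"
    proof -
      have "card (edges k n S) \<le> card ({1..k} \<times> {1..n})"
        by (rule card_mono) (auto simp: edges_def)
      then show ?thesis by (simp only: sum_constant of_nat_le_iff mult_1_right)
    qed
    finally show "\<bar>?h d S\<bar> \<le> real (card ({1..k} \<times> {1..n}))" .
  qed
  have g: "g (deg S i c) = (\<Sum>d\<le>N. g d * of_bool (deg S i c = d))" for S i c
    using deg[of S i c] by (simp add: of_bool_def if_distrib cong: if_cong)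
  have "(\<Sum>(i, c)\<in>edges k n S. g (deg S i c)) = (\<Sum>d\<le>N. g d * ?h d S)" for S
  proof -
    have "(\<Sum>(i, c)\<in>edges k n S. g (deg S i c)) =
        (\<Sum>p\<in>edges k n S. \<Sum>d\<le>N. g d * of_bool (deg S (fst p) (snd p) = d))"
      by (simp only: case_prod_unfold g[symmetric])
    also have "\<dots> = (\<Sum>d\<le>N. \<Sum>p\<in>edges k n S. g d * of_bool (deg S (fst p) (snd p) = d))"
      by (rule sum.swap)
    finally show ?thesis by (simp only: sum_distrib_left case_prod_unfold)
  qed
  then have "(\<integral>x. (\<Sum>(i, c)\<in>edges k n (fst x). g (deg (fst x) i c)) \<partial>M)
      = (\<Sum>d\<le>N. g d * (\<integral>x. ?h d (fst x) \<partial>M))"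
    using int by simp
  then show ?thesis
    by (simp only: edge_mean_def sum_divide_distrib times_divide_eq_right)
qed

lemma edge_mean_input_degree:
  fixes g \<rho> \<mu> :: "nat \<Rightarrow> real" and k n :: nat and \<Omega> :: "nat pmf"
  assumes "s > 0"
  defines "M \<equiv> lt_space k n \<Omega> \<rho> \<mu> s"
  shows "edge_mean k n M (\<lambda>x i c. g (input_degree n x i)) =
    (\<Sum>d\<le>n. g d * input_edge_degree k n M d)"
  unfolding input_edge_degree_def input_degree_def M_def
proof (rule edge_mean_degree[OF \<open>s > 0\<close>])
  show "card {c \<in> {1..n}. i \<in> S c} \<le> n" for i and S :: "nat \<Rightarrow> nat set"
    by (rule order_trans[OF card_mono[of "{1..n}"]]) auto
qed

lemma edge_mean_output_degree:
  fixes g \<rho> \<mu> :: "nat \<Rightarrow> real" and k n :: nat and \<Omega> :: "nat pmf"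
  assumes "s > 0"
  defines "M \<equiv> lt_space k n \<Omega> \<rho> \<mu> s"
  shows "edge_mean k n M (\<lambda>x i c. g (output_degree k x c)) =
    (\<Sum>d\<le>k. g d * output_edge_degree k n M d)"
  unfolding output_edge_degree_def output_degree_def M_def
proof (rule edge_mean_degree[OF \<open>s > 0\<close>])
  show "card {i \<in> {1..k}. i \<in> S c} \<le> k" for c and S :: "nat \<Rightarrow> nat set"
    by (rule order_trans[OF card_mono[of "{1..k}"]]) auto
qed

end

theory Submission
  imports Defs
begin

text \<open>In the first round an input node adds to its flipped prior the messages of its other output
  nodes, so the claim is that each of these has positive mean for a fixed code graph. By the
  \<open>tanh\<close> rule such a message is an odd function of the channel output and of the product of the
  \<open>tanh (m i / 2)\<close>. That product is a constant in \<open>(0, 1]\<close> times a random sign of positive mean,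
  because a flipped prior is more often positive than negative. It remains to see that an odd
  increasing function of a Gaussian with positive mean has positive mean, by reflection in that
  mean. Strictness holds on average over the graph: as the output nodes are independent, the code in
  which they all select the same subset has positive probability, so an input node that can be
  adjacent to \<open>c\<close> is with positive probability also adjacent to a second output node.\<close>

section \<open>The message of an output node\<close>

text \<open>The output message as a function of the channel value \<open>v\<close> and the product
  \<open>x\<close> of the incoming \<open>tanh\<close> values. For \<bar>x\<bar> \<le> 1 the
  argument of \<open>artanh\<close> stays strictly inside (-1, 1).\<close>

definition check_node :: "real \<Rightarrow> real \<Rightarrow> real" where
  "check_node x v = 2 * artanh (tanh (v / 2) * x)"

lemma abs_tanh_less_1: "\<bar>tanh z\<bar> < (1 :: real)"
  using tanh_real_lt_1[of z] tanh_real_gt_neg1[of z] by linarith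

lemma tanh_check_node:
  assumes "\<bar>x\<bar> \<le> 1"
  shows "tanh (check_node x v / 2) = tanh (v / 2) * x"
proof -
  have "\<bar>tanh (v / 2) * x\<bar> \<le> \<bar>tanh (v / 2)\<bar>"
    using assms by (simp add: abs_mult mult_left_le)
  also have "\<dots> < 1"
    by (rule abs_tanh_less_1)
  finally show ?thesis
    by (simp add: check_node_def tanh_artanh_real)
qed

text \<open>Injectivity of \<open>tanh\<close> characterises the message by its \<open>tanh\<close>;
  both symmetries below then follow without touching \<open>artanh\<close>.\<close>

lemma check_node_eqI:
  assumes "\<bar>x\<bar> \<le> 1" "tanh (z / 2) = tanh (v / 2) * x"
  shows "check_node x v = z"
  using tanh_check_node[OF assms(1), of v] assms(2) tanh_real_eq_iff[of "check_node x v / 2" "z / 2"]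
  by simp

lemma check_node_minus_left: "\<bar>x\<bar> \<le> 1 \<Longrightarrow> check_node (- x) v = - check_node x v"
  by (rule check_node_eqI) (simp_all add: tanh_check_node)

lemma check_node_minus_right: "\<bar>x\<bar> \<le> 1 \<Longrightarrow> check_node x (- v) = - check_node x v"
  by (rule check_node_eqI) (simp_all add: tanh_check_node)

text \<open>Multiplying by a factor of modulus at most 1 cannot increase reliability. This makes the
  channel output an integrable majorant of every round-0 output message.\<close>

lemma abs_check_node_le:
  assumes "\<bar>x\<bar> \<le> 1"
  shows "\<bar>check_node x v\<bar> \<le> \<bar>v\<bar>"
proof -
  have "tanh (\<bar>check_node x v\<bar> / 2) = \<bar>tanh (v / 2)\<bar> * \<bar>x\<bar>"
    using tanh_check_node[OF assms, of v] tanh_real_abs[of "check_node x v / 2"]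
    by (simp add: abs_mult)
  also have "\<dots> \<le> tanh (\<bar>v\<bar> / 2)"
    using assms tanh_real_abs[of "v / 2"] by (simp add: mult_left_le)
  finally show ?thesis
    by simp
qed

lemma check_node_strict_mono:
  assumes "0 < x" "x \<le> 1" "v < w"
  shows "check_node x v < check_node x w"
proof -
  have "tanh (check_node x v / 2) < tanh (check_node x w / 2)"
    using assms by (simp add: tanh_check_node)
  then show ?thesis
    by simp
qed

lemma borel_measurable_tanh [measurable]: "tanh \<in> borel_measurable (borel :: real measure)"
  by (intro borel_measurable_continuous_onI continuous_intros) auto

lemma borel_measurable_check_node [measurable]:
  "case_prod check_node \<in> borel_measurable (borel \<Otimes>\<^sub>M borel)"
  unfolding check_node_def artanh_def by measurable

section \<open>Means over channel and priors\<close>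

lemma integrable_gaussian_id:
  assumes "s > 0"
  shows "integrable (density lborel (normal_density \<mu> s)) (\<lambda>v. v)"
  using assms by (subst integrable_density) (simp_all add: integrable_normal_moment_nz_1)

text \<open>Reflection in the mean \<open>\<mu>\<close> preserves the law and turns \<open>h v\<close> into
  \<open>h (2 * \<mu> - v) = - h (v - 2 * \<mu>) > - h v\<close>.\<close>

lemma gaussian_mean_odd_strict_mono_pos:
  fixes h :: "real \<Rightarrow> real"
  assumes "s > 0" "\<mu> > 0"
    and odd: "\<And>v. h (- v) = - h v" and mono: "strict_mono h"
    and int: "integrable (density lborel (normal_density \<mu> s)) h"
  shows "0 < (\<integral>v. h v \<partial>density lborel (normal_density \<mu> s))"
proof -
  let ?N = "density lborel (normal_density \<mu> s)"
  interpret N: prob_space ?N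
    using \<open>s > 0\<close> by (rule prob_space_normal_density)
  have [measurable]: "h \<in> borel_measurable borel"
    using borel_measurable_integrable[OF int] by simp
  have refl_density: "normal_density \<mu> s (2 * \<mu> - v) = normal_density \<mu> s v" for v
    by (simp add: normal_density_def power2_commute[of "\<mu>"])
  \<comment> \<open>The reflection is the affine map with slope -1 and offset
    \<open>2 * \<mu>\<close>, applied under Lebesgue measure to the integrand including its
    density.\<close>
  have int': "integrable lborel (\<lambda>v. normal_density \<mu> s v * h v)"
    using int by (subst (asm) integrable_density) auto
  have int_refl: "integrable ?N (\<lambda>v. h (2 * \<mu> - v))"
    using lborel_integrable_real_affine[OF int', of "-1" "2 * \<mu>"]
    by (subst integrable_density) (auto simp: refl_density)
  have refl: "(\<integral>v. h (2 * \<mu> - v) \<partial>?N) = (\<integral>v. h v \<partial>?N)"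
    using lborel_integral_real_affine[of "-1" "\<lambda>v. normal_density \<mu> s v * h v" "2 * \<mu>"]
    by (simp add: integral_density refl_density)
  have "- h (2 * \<mu> - v) < h v" for v
  proof -
    have "- h (2 * \<mu> - v) = h (v - 2 * \<mu>)"
      by (simp flip: odd)
    also have "\<dots> < h v"
      using \<open>\<mu> > 0\<close> by (intro strict_monoD[OF mono]) simp
    finally show ?thesis .
  qed
  then have "(\<integral>v. - h (2 * \<mu> - v) \<partial>?N) < (\<integral>v. h v \<partial>?N)"
    using int int_refl by (intro N.integral_less_AE_space) (simp_all add: N.emeasure_space_1[simplified])
  \<comment> \<open>By \<open>refl\<close> the left side is minus the right side.\<close>
  then show ?thesis
    by (simp add: refl)
qed

lemma integrable_check_node:
  assumes "s > 0" "\<bar>x\<bar> \<le> 1"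
  shows "integrable (density lborel (normal_density \<mu> s)) (check_node x)"
proof (rule Bochner_Integration.integrable_bound[OF integrable_gaussian_id[OF \<open>s > 0\<close>]])
  show "AE v in density lborel (normal_density \<mu> s). norm (check_node x v) \<le> norm v"
    using abs_check_node_le[OF assms(2)] by simp
qed simp

lemma gaussian_mean_check_node_pos:
  assumes "s > 0" "\<mu> > 0" "0 < x" "x \<le> 1"
  shows "0 < (\<integral>v. check_node x v \<partial>density lborel (normal_density \<mu> s))"
  using assms
  by (intro gaussian_mean_odd_strict_mono_pos integrable_check_node)
     (auto simp: check_node_minus_right strict_mono_def check_node_strict_mono)

lemma set_flipped_prior_pmf: "set_pmf (flipped_prior_pmf x) \<subseteq> {\<bar>x\<bar>, - \<bar>x\<bar>}"
  by (auto simp: flipped_prior_pmf_def)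

text \<open>The mean is \<open>2 * sigmoid \<bar>x\<bar> - 1\<close>, and \<open>sigmoid\<close>
  exceeds 1/2 on positive arguments.\<close>

lemma flipped_prior_mean_sgn_pos:
  assumes "x \<noteq> 0"
  shows "0 < (\<integral>y. sgn y \<partial>flipped_prior_pmf x)"
proof -
  have "exp (- \<bar>x\<bar>) < 1"
    using assms by simp
  then have "1 / 2 < sigmoid \<bar>x\<bar>" "sigmoid \<bar>x\<bar> < 1"
    by (simp_all add: sigmoid_def field_simps add_pos_pos)
  then show ?thesis
    using assms by (simp add: flipped_prior_pmf_def)
qed

text \<open>Independence of the flipped priors factorises the mean of the product into positive
  means.\<close>

lemma prior_mean_prod_sgn_pos:
  assumes "finite I" "A \<subseteq> I" "\<And>i. i \<in> I \<Longrightarrow> \<mu> i \<noteq> 0"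
  shows "0 < (\<integral>m. (\<Prod>i\<in>A. sgn (m i)) \<partial>Pi_pmf I 0 (\<lambda>i. flipped_prior_pmf (\<mu> i)))"
proof -
  let ?P = "Pi_pmf I 0 (\<lambda>i. flipped_prior_pmf (\<mu> i))"
  have "prob_space.indep_vars ?P (\<lambda>_. count_space UNIV) (\<lambda>i m. m i) A"
    by (rule prob_space.indep_vars_subset[OF measure_pmf.prob_space_axioms indep_vars_Pi_pmf]) fact+
  then have indep: "prob_space.indep_vars ?P (\<lambda>_. borel) (\<lambda>i m. sgn (m i)) A"
    by (rule prob_space.indep_vars_compose2[OF measure_pmf.prob_space_axioms]) simp
  have "(\<integral>m. (\<Prod>i\<in>A. sgn (m i)) \<partial>?P) = (\<Prod>i\<in>A. \<integral>m. sgn (m i) \<partial>?P)"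
  proof (rule prob_space.indep_vars_lebesgue_integral[OF measure_pmf.prob_space_axioms _ indep])
    show "integrable ?P (\<lambda>m. sgn (m i))" for i
      by (rule measure_pmf.integrable_const_bound[of _ 1]) (auto simp: sgn_if)
  qed (use assms in \<open>auto intro: finite_subset\<close>)
  also have "\<dots> = (\<Prod>i\<in>A. \<integral>y. sgn y \<partial>flipped_prior_pmf (\<mu> i))"
  proof (rule prod.cong[OF refl])
    fix i assume "i \<in> A"
    then have "map_pmf (\<lambda>m. m i) ?P = flipped_prior_pmf (\<mu> i)"
      using assms by (subst Pi_pmf_component) auto
    then show "(\<integral>m. sgn (m i) \<partial>?P) = (\<integral>y. sgn y \<partial>flipped_prior_pmf (\<mu> i))"
      by (metis integral_map_pmf)
  qed
  also have "\<dots> > 0"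
    using assms by (intro prod_pos flipped_prior_mean_sgn_pos) auto
  finally show ?thesis .
qed

text \<open>Flipping changes only signs, so on the support the product is plus or minus one fixed
  \<open>r\<close>, and oddness of \<open>g\<close> pulls the sign out. For empty \<open>A\<close>
  both products are 1, hence the endpoint \<open>x = 1\<close> in the positivity assumption.\<close>

lemma prior_mean_odd_prod_tanh_pos:
  fixes g :: "real \<Rightarrow> real"
  assumes "finite I" "A \<subseteq> I" "\<And>i. i \<in> I \<Longrightarrow> \<mu> i \<noteq> 0"
    and odd: "\<And>x. \<bar>x\<bar> \<le> 1 \<Longrightarrow> g (- x) = - g x"
    and pos: "\<And>x. 0 < x \<Longrightarrow> x \<le> 1 \<Longrightarrow> 0 < g x"
  shows "0 < (\<integral>m. g (\<Prod>i\<in>A. tanh (m i / 2)) \<partial>Pi_pmf I 0 (\<lambda>i. flipped_prior_pmf (\<mu> i)))"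
proof -
  let ?P = "Pi_pmf I 0 (\<lambda>i. flipped_prior_pmf (\<mu> i))"
  define r where "r = (\<Prod>i\<in>A. tanh (\<bar>\<mu> i\<bar> / 2))"
  have "finite A"
    using assms by (auto intro: finite_subset)
  have r: "0 < r" "r \<le> 1"
    unfolding r_def using assms tanh_real_lt_1
    by (auto intro!: prod_pos prod_le_1 simp: less_imp_le)
  have "g (\<Prod>i\<in>A. tanh (m i / 2)) = (\<Prod>i\<in>A. sgn (m i)) * g r" if "m \<in> set_pmf ?P" for m
  proof -
    have m: "\<bar>m i\<bar> = \<bar>\<mu> i\<bar>" if "i \<in> A" for i
    proof -
      have "m i \<in> set_pmf (flipped_prior_pmf (\<mu> i))"
        using that \<open>m \<in> set_pmf ?P\<close> assms by (auto simp: set_Pi_pmf PiE_dflt_def)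
      then show ?thesis
        using set_flipped_prior_pmf[of "\<mu> i"] by auto
    qed
    have "tanh (m i / 2) = sgn (m i) * tanh (\<bar>\<mu> i\<bar> / 2)" if "i \<in> A" for i
      unfolding m[OF that, symmetric] by (simp add: sgn_if abs_if)
    then have "(\<Prod>i\<in>A. tanh (m i / 2)) = (\<Prod>i\<in>A. sgn (m i)) * r"
      by (simp add: r_def prod.distrib)
    moreover have "\<bar>\<Prod>i\<in>A. sgn (m i)\<bar> = 1"
      using assms m by (auto simp: abs_prod intro!: prod.neutral) (metis abs_sgn_eq_1 abs_zero abs_eq_0 subsetD)
    then have "(\<Prod>i\<in>A. sgn (m i)) = 1 \<or> (\<Prod>i\<in>A. sgn (m i)) = - 1"
      by linarith
    ultimately show ?thesis
      using odd[of r] r by auto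
  qed
  then have "(\<integral>m. g (\<Prod>i\<in>A. tanh (m i / 2)) \<partial>?P) = (\<integral>m. (\<Prod>i\<in>A. sgn (m i)) * g r \<partial>?P)"
    by (intro integral_cong_AE) (auto simp: AE_measure_pmf_iff)
  also have "\<dots> = (\<integral>m. (\<Prod>i\<in>A. sgn (m i)) \<partial>?P) * g r"
    by simp
  also have "\<dots> > 0"
    using assms r by (intro mult_pos_pos prior_mean_prod_sgn_pos pos) auto
  finally show ?thesis .
qed

section \<open>Integrability of functions of one coordinate of a product\<close>

lemma integrable_comp_fst:
  fixes f :: "_ \<Rightarrow> real"
  assumes "prob_space M" "prob_space N" and f: "integrable M f"
  shows "integrable (M \<Otimes>\<^sub>M N) (\<lambda>x. f (fst x))"
proof -
  interpret N: prob_space N by fact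
  have "integrable (distr (M \<Otimes>\<^sub>M N) M fst) f"
    using f by (simp add: N.distr_pair_fst)
  then show ?thesis
    by (rule integrable_distr[rotated]) simp
qed

lemma integrable_comp_snd:
  fixes f :: "_ \<Rightarrow> real"
  assumes "prob_space M" "prob_space N" and f: "integrable N f"
  shows "integrable (M \<Otimes>\<^sub>M N) (\<lambda>x. f (snd x))"
proof -
  interpret M: prob_space M by fact
  interpret N: prob_space N by fact
  interpret pair_sigma_finite N M ..
  show ?thesis
    using integrable_product_swap[OF integrable_comp_fst[OF assms(2,1) f]]
    by (simp add: case_prod_unfold)
qed

section \<open>The first decoding round\<close>

lemma output_msg_0:
  "output_msg k n x 0 c i = check_node
     (\<Prod>i' | i' \<in> {1..k} \<and> i' \<in> fst x c \<and> i' \<noteq> i. tanh (fst (snd x) i' / 2)) (snd (snd x) c)"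
  by (simp add: output_msg_def output_update_def check_node_def case_prod_unfold)

lemma abs_output_msg_0_le: "\<bar>output_msg k n x 0 c i\<bar> \<le> \<bar>snd (snd x) c\<bar>"
  unfolding output_msg_0
  by (intro abs_check_node_le) (auto simp: abs_prod intro!: prod_le_1 less_imp_le[OF abs_tanh_less_1])

text \<open>\<open>n_ge_2\<close> provides a second output node, without which the first iteration
  changes no message. \<open>degrees\<close> excludes degree 0, so that edges exist, and
  \<open>norm_pos\<close> makes the selection weights a probability distribution.\<close>

locale lt_code =
  fixes k n :: nat and \<Omega> :: "nat pmf" and \<rho> \<mu> :: "nat \<Rightarrow> real" and s :: real
  assumes n_ge_2: "n \<ge> 2"
    and degrees: "set_pmf \<Omega> \<subseteq> {1..k}"
    and selection: "\<And>j. j \<in> {1..k} \<Longrightarrow> 0 \<le> \<rho> j \<and> \<rho> j \<le> 1"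
    and norm_pos: "\<And>d. d \<in> set_pmf \<Omega> \<Longrightarrow> subset_norm k \<rho> d > 0"
    and s_pos: "s > 0"
    and nontrivial: "\<And>i. i \<in> {1..k} \<Longrightarrow> \<bar>\<mu> i\<bar> > 0"
begin

section \<open>The product space of graphs, priors and channel outputs\<close>

abbreviation "C \<equiv> code_pmf k n \<Omega> \<rho>"
abbreviation "P \<equiv> Pi_pmf {1..k} 0 (\<lambda>i. flipped_prior_pmf (\<mu> i))"
abbreviation "N \<equiv> density lborel (normal_density (s\<^sup>2 / 2) s)"
abbreviation "V \<equiv> \<Pi>\<^sub>M c\<in>{1..n}. N"
abbreviation "M \<equiv> lt_space k n \<Omega> \<rho> \<mu> s"

sublocale N: prob_space N
  using s_pos by (rule prob_space_normal_density)

sublocale V: product_prob_space "\<lambda>_ :: nat. N" "{1..n}"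
  by unfold_locales

sublocale V: prob_space V
  by (rule V.prob_space_axioms)

sublocale PV: pair_prob_space P V
  by (intro pair_prob_space.intro pair_sigma_finite.intro measure_pmf.prob_space_axioms
      prob_space_imp_sigma_finite V.prob_space_axioms)

sublocale CPV: pair_prob_space C "P \<Otimes>\<^sub>M V"
  by (intro pair_prob_space.intro pair_sigma_finite.intro measure_pmf.prob_space_axioms
      prob_space_imp_sigma_finite PV.prob_space_axioms)

sublocale M: prob_space M
  using s_pos by (rule prob_space_lt_space)

lemma M_eq: "M = C \<Otimes>\<^sub>M (P \<Otimes>\<^sub>M V)"
  by (simp add: lt_space_def)

text \<open>Fubini with the graph outermost, so that means over priors and channel can be taken for
  a fixed code.\<close>

lemma integral_M:
  fixes f :: "outcome \<Rightarrow> real"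
  assumes "integrable M f"
  shows "(\<integral>x. f x \<partial>M) = (\<integral>S. \<integral>y. f (S, y) \<partial>(P \<Otimes>\<^sub>M V) \<partial>C)"
  using assms unfolding M_eq by (rule CPV.integral_fst'[symmetric])

text \<open>Only the signs of the priors are random; with finite support, integrability of each
  prior is immediate.\<close>

lemma finite_set_P: "finite (set_pmf P)"
proof -
  have "finite (set_pmf (flipped_prior_pmf (\<mu> i)))" for i
    by (rule finite_subset[OF set_flipped_prior_pmf]) simp
  then show ?thesis
    by (intro finite_subset[OF set_Pi_pmf_subset'] finite_PiE_dflt) auto
qed

lemma integrable_prior: "integrable M (\<lambda>x. fst (snd x) i)"
proof -
  have "integrable P (\<lambda>m. m i)"
    by (rule integrable_measure_pmf_finite[OF finite_set_P])
  then have "integrable (P \<Otimes>\<^sub>M V) (\<lambda>y. fst y i)"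
    by (intro integrable_comp_fst measure_pmf.prob_space_axioms V.prob_space_axioms)
  then show ?thesis
    unfolding M_eq
    by (intro integrable_comp_snd measure_pmf.prob_space_axioms PV.prob_space_axioms)
qed

lemma V_component:
  assumes "c \<in> {1..n}"
  shows "distr V N (\<lambda>v. v c) = N"
  using V.PiM_component[OF assms] by simp

lemma integral_V_component:
  fixes f :: "real \<Rightarrow> real"
  assumes "c \<in> {1..n}" and [measurable]: "f \<in> borel_measurable borel"
  shows "(\<integral>v. f (v c) \<partial>V) = (\<integral>z. f z \<partial>N)"
proof -
  have "(\<integral>z. f z \<partial>N) = (\<integral>z. f z \<partial>distr V N (\<lambda>v. v c))"
    using V_component[OF assms(1)] by simp
  also have "\<dots> = (\<integral>v. f (v c) \<partial>V)"
    using assms(1) by (intro integral_distr) auto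
  finally show ?thesis ..
qed

lemma integrable_channel_PV:
  assumes "c \<in> {1..n}"
  shows "integrable (P \<Otimes>\<^sub>M V) (\<lambda>y. snd y c)"
proof -
  have "integrable (distr V N (\<lambda>v. v c)) (\<lambda>v. v)"
    using V_component[OF assms] integrable_gaussian_id[OF s_pos] by simp
  then have "integrable V (\<lambda>v. v c)"
    by (rule integrable_distr[rotated]) (use assms in measurable)
  then show ?thesis
    by (intro integrable_comp_snd measure_pmf.prob_space_axioms V.prob_space_axioms)
qed

lemma integrable_channel:
  assumes "c \<in> {1..n}"
  shows "integrable M (\<lambda>x. snd (snd x) c)"
  unfolding M_eq
  by (rule integrable_comp_snd[OF measure_pmf.prob_space_axioms PV.prob_space_axioms
        integrable_channel_PV[OF assms]])

section \<open>Measurability and integrability of the round-0 output messages\<close>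

lemma measurable_edge [measurable]: "Measurable.pred M (\<lambda>x. i \<in> fst x c)"
  unfolding M_eq by (rule measurable_compose[OF measurable_fst]) simp

lemma measurable_output_msg_0:
  assumes [measurable]: "c \<in> {1..n}"
  shows "(\<lambda>x. output_msg k n x 0 c i) \<in> borel_measurable M"
proof -
  \<comment> \<open>The index set depends on the graph; padding with factors 1 turns this into a
    product over the fixed set \<open>{1..k}\<close>.\<close>
  have "(\<Prod>i' | i' \<in> {1..k} \<and> i' \<in> fst x c \<and> i' \<noteq> i. tanh (fst (snd x) i' / 2)) =
      (\<Prod>i'\<in>{1..k}. if i' \<in> fst x c \<and> i' \<noteq> i then tanh (fst (snd x) i' / 2) else 1)"
    for x :: outcome
    by (rule trans[OF _ prod.inter_filter]) (auto intro: prod.cong)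
  moreover have [measurable]: "(\<lambda>x. fst (snd x) j) \<in> borel_measurable M" for j
    by (rule borel_measurable_integrable[OF integrable_prior])
  moreover have [measurable]: "(\<lambda>x. snd (snd x) c) \<in> borel_measurable M"
    by (rule borel_measurable_integrable[OF integrable_channel[OF assms]])
  ultimately show ?thesis
    unfolding output_msg_0 by (simp only:) measurable
qed

lemma integrable_edge_mult:
  fixes f :: "outcome \<Rightarrow> real"
  assumes [measurable]: "integrable M f"
  shows "integrable M (\<lambda>x. of_bool (i \<in> fst x c) * f x)"
  by (rule Bochner_Integration.integrable_bound[OF assms]) (auto simp: of_bool_def)

lemma integrable_output_msg_0:
  assumes "c \<in> {1..n}"
  shows "integrable M (\<lambda>x. output_msg k n x 0 c i)"
  using measurable_output_msg_0[OF assms] abs_output_msg_0_le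
  by (intro Bochner_Integration.integrable_bound[OF integrable_channel[OF assms]]) auto

text \<open>Averaging over the channel first leaves a function \<open>g\<close> of the
  \<open>tanh\<close> product that is odd, and positive on (0, 1] because the channel mean is
  positive. The average over the random signs is then positive as well.\<close>

lemma mean_output_msg_0_pos:
  assumes "c \<in> {1..n}"
  shows "0 < (\<integral>y. output_msg k n (S, y) 0 c i \<partial>(P \<Otimes>\<^sub>M V))"
proof -
  let ?A = "{i'. i' \<in> {1..k} \<and> i' \<in> S c \<and> i' \<noteq> i}"
  let ?t = "\<lambda>m :: nat \<Rightarrow> real. \<Prod>i'\<in>?A. tanh (m i' / 2)"
  define g where "g x = (\<integral>z. check_node x z \<partial>N)" for x
  have [measurable]: "(\<lambda>y. snd y c) \<in> borel_measurable (P \<Otimes>\<^sub>M V)"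
    by (rule borel_measurable_integrable[OF integrable_channel_PV[OF assms]])
  have [measurable]: "(\<lambda>y. ?t (fst y)) \<in> borel_measurable (P \<Otimes>\<^sub>M V)"
    by (rule measurable_compose[OF measurable_fst]) simp
  have "integrable (P \<Otimes>\<^sub>M V) (\<lambda>y. check_node (?t (fst y)) (snd y c))"
  proof (rule Bochner_Integration.integrable_bound[OF integrable_channel_PV[OF assms]])
    show "AE y in P \<Otimes>\<^sub>M V. norm (check_node (?t (fst y)) (snd y c)) \<le> norm (snd y c)"
      using abs_output_msg_0_le[of k n "(S, _)" c i] by (auto simp: output_msg_0)
  qed measurable
  then have "(\<integral>y. output_msg k n (S, y) 0 c i \<partial>(P \<Otimes>\<^sub>M V)) =
      (\<integral>m. \<integral>v. check_node (?t m) (v c) \<partial>V \<partial>P)"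
    by (subst PV.integral_fst'[symmetric]) (simp_all add: output_msg_0)
  also have "\<dots> = (\<integral>m. g (?t m) \<partial>P)"
    unfolding g_def
    by (intro Bochner_Integration.integral_cong refl integral_V_component[OF assms]) measurable
  also have "\<dots> > 0"
  proof (rule prior_mean_odd_prod_tanh_pos)
    show "g (- x) = - g x" if "\<bar>x\<bar> \<le> 1" for x
      using that by (simp add: g_def check_node_minus_left)
    show "0 < g x" if "0 < x" "x \<le> 1" for x
      using that s_pos unfolding g_def by (intro gaussian_mean_check_node_pos) auto
  qed (use nontrivial in auto)
  finally show ?thesis .
qed

section \<open>Code graphs of positive probability\<close>

lemma measure_edge: "measure M {x \<in> space M. i \<in> fst x c} = measure C {S. i \<in> S c}"
proof -
  have "measure C {S. i \<in> S c} = measure (distr M C fst) {S. i \<in> S c}"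
    unfolding M_eq by (simp only: PV.distr_pair_fst)
  also have "\<dots> = measure M (fst -` {S. i \<in> S c} \<inter> space M)"
    by (rule measure_distr) (simp_all add: M_eq)
  also have "fst -` {S. i \<in> S c} \<inter> space M = {x \<in> space M. i \<in> fst x c}"
    by auto
  finally show ?thesis ..
qed

lemma set_code_pmf: "set_pmf C = PiE_dflt {1..n} {} (\<lambda>_. set_pmf (bind_pmf \<Omega> (subset_pmf k \<rho>)))"
  by (simp add: code_pmf_def set_Pi_pmf comp_def)

text \<open>By independence the support of the code is a product, so all output nodes may select the
  same \<open>T\<close>. The value \<open>{}\<close> outside \<open>{1..n}\<close> is the default
  built into \<open>code_pmf\<close>.\<close>

lemma constant_code_in_set_code_pmf:
  assumes "T \<in> set_pmf (bind_pmf \<Omega> (subset_pmf k \<rho>))"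
  shows "(\<lambda>c. if c \<in> {1..n} then T else {}) \<in> set_pmf C"
  using assms unfolding set_code_pmf PiE_dflt_def by auto

lemma measure_edge_pos_iff: "measure M {x \<in> space M. i \<in> fst x c} > 0 \<longleftrightarrow> (\<exists>S\<in>set_pmf C. i \<in> S c)"
proof -
  have "measure C {S. i \<in> S c} = 0 \<longleftrightarrow> (AE S in C. S \<notin> {S. i \<in> S c})"
    by (rule measure_pmf.prob_eq_0) simp
  then show ?thesis
    unfolding measure_edge zero_less_measure_iff by (auto simp: AE_measure_pmf_iff)
qed

lemma code_contains_edges:
  assumes "c \<in> {1..n}" "measure M {x \<in> space M. i \<in> fst x c} > 0"
  obtains S where "S \<in> set_pmf C" "\<And>c. c \<in> {1..n} \<Longrightarrow> i \<in> S c"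
proof -
  \<comment> \<open>\<open>T\<close> is the subset selected for \<open>c\<close> in some graph of
    the support that contains the edge.\<close>
  obtain T where T: "T \<in> set_pmf (bind_pmf \<Omega> (subset_pmf k \<rho>))" "i \<in> T"
    using assms unfolding measure_edge_pos_iff set_code_pmf PiE_dflt_def by blast
  show thesis
    using T(2) by (intro that[OF constant_code_in_set_code_pmf[OF T(1)]]) simp
qed

text \<open>For a fixed graph both indicators are constants multiplying the positive mean
  \<open>w S\<close>, which gives nonnegativity. Strictness comes from a graph in which
  \<open>i\<close> is adjacent to \<open>c\<close> and \<open>c'\<close> at once.\<close>

lemma mean_output_msg_0_on_edges:
  fixes c c' i :: nat
  assumes "c' \<in> {1..n}"
  defines "I \<equiv> (\<integral>x. of_bool (i \<in> fst x c) * (of_bool (i \<in> fst x c') * output_msg k n x 0 c' i) \<partial>M)"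
  shows "0 \<le> I"
    and "c \<in> {1..n} \<Longrightarrow> measure M {x \<in> space M. i \<in> fst x c} > 0 \<Longrightarrow> 0 < I"
proof -
  define w where "w S = (\<integral>y. output_msg k n (S, y) 0 c' i \<partial>(P \<Otimes>\<^sub>M V))" for S
  define f where "f S = of_bool (i \<in> S c) * (of_bool (i \<in> S c') * w S)" for S
  have w: "0 < w S" for S
    unfolding w_def by (rule mean_output_msg_0_pos) fact
  have int: "integrable M (\<lambda>x. of_bool (i \<in> fst x c) * (of_bool (i \<in> fst x c') * output_msg k n x 0 c' i))"
    by (intro integrable_edge_mult integrable_output_msg_0) fact
  have I: "I = (\<integral>S. f S \<partial>C)"
    unfolding I_def f_def w_def by (subst integral_M[OF int]) simp
  have int_f: "integrable C f"
    using CPV.integrable_fst'[OF int[unfolded M_eq]] by (simp add: f_def[abs_def] w_def)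
  have nonneg: "0 \<le> f S" for S
    using w[of S] by (simp add: f_def)
  then show "0 \<le> I"
    unfolding I by simp
  assume "c \<in> {1..n}" "measure M {x \<in> space M. i \<in> fst x c} > 0"
  then obtain S where S: "S \<in> set_pmf C" "\<And>c. c \<in> {1..n} \<Longrightarrow> i \<in> S c"
    using code_contains_edges by blast
  have "f S > 0"
    using S \<open>c \<in> {1..n}\<close> assms(1) w by (simp add: f_def)
  \<comment> \<open>\<open>S\<close> is an atom of the discrete law \<open>C\<close>, so a positive
    value there rules out vanishing almost everywhere.\<close>
  then have "\<not> (AE S in C. f S = 0)"
    using S(1) by (force simp: AE_measure_pmf_iff)
  then have "I \<noteq> 0"
    unfolding I using integral_nonneg_eq_0_iff_AE[OF int_f] nonneg by simp
  with \<open>0 \<le> I\<close> show "0 < I"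
    by simp
qed

text \<open>Moving adjacency from the index set into a factor leaves a sum over a fixed set, which
  can be integrated term by term.\<close>

lemma input_msg_1:
  "input_msg k n x 1 i c =
     input_msg k n x 0 i c +
     (\<Sum>c'\<in>{1..n} - {c}. of_bool (i \<in> fst x c') * output_msg k n x 0 c' i)"
proof -
  have "(\<Sum>c' | c' \<in> {1..n} \<and> i \<in> fst x c' \<and> c' \<noteq> c. output_msg k n x 0 c' i) =
      (\<Sum>c'\<in>{1..n} - {c}. if i \<in> fst x c' then output_msg k n x 0 c' i else 0)"
    by (rule trans[OF _ sum.inter_filter]) (auto intro: sum.cong)
  also have "\<dots> = (\<Sum>c'\<in>{1..n} - {c}. of_bool (i \<in> fst x c') * output_msg k n x 0 c' i)"
    by (intro sum.cong) auto
  finally show ?thesis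
    using input_msg_rule[of k n "fst x" "fst (snd x)" "snd (snd x)" 0 i c] by simp
qed

lemma integrable_input_msg_0: "integrable M (\<lambda>x. input_msg k n x 0 i c)"
  using integrable_prior by simp

lemma integrable_input_msg_1: "integrable M (\<lambda>x. input_msg k n x 1 i c)"
  unfolding input_msg_1
  by (intro Bochner_Integration.integrable_add Bochner_Integration.integrable_sum
      integrable_edge_mult integrable_output_msg_0 integrable_input_msg_0) simp

text \<open>The prior terms cancel, and \<open>I 1 - I 0\<close> is the sum of the means
  \<open>?J c'\<close> over the other output nodes.\<close>

lemma mean_input_msg_1_on_edges:
  fixes i c :: nat
  defines "I l \<equiv> (\<integral>x. of_bool (i \<in> fst x c) * input_msg k n x l i c \<partial>M)"
  shows "I 0 \<le> I 1"
    and "c \<in> {1..n} \<Longrightarrow> measure M {x \<in> space M. i \<in> fst x c} > 0 \<Longrightarrow> I 0 < I 1"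
proof -
  let ?J = "\<lambda>c'. \<integral>x. of_bool (i \<in> fst x c) * (of_bool (i \<in> fst x c') * output_msg k n x 0 c' i) \<partial>M"
  have "I 1 = (\<integral>x. of_bool (i \<in> fst x c) * input_msg k n x 0 i c +
      (\<Sum>c'\<in>{1..n} - {c}. of_bool (i \<in> fst x c) *
        (of_bool (i \<in> fst x c') * output_msg k n x 0 c' i)) \<partial>M)"
    unfolding I_def input_msg_1 by (simp only: distrib_left sum_distrib_left)
  also have "\<dots> = I 0 + (\<integral>x. (\<Sum>c'\<in>{1..n} - {c}. of_bool (i \<in> fst x c) *
        (of_bool (i \<in> fst x c') * output_msg k n x 0 c' i)) \<partial>M)"
    unfolding I_def
    by (intro Bochner_Integration.integral_add Bochner_Integration.integrable_sum
        integrable_edge_mult integrable_output_msg_0 integrable_input_msg_0) simp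
  also have "(\<integral>x. (\<Sum>c'\<in>{1..n} - {c}. of_bool (i \<in> fst x c) *
        (of_bool (i \<in> fst x c') * output_msg k n x 0 c' i)) \<partial>M) = (\<Sum>c'\<in>{1..n} - {c}. ?J c')"
    by (intro Bochner_Integration.integral_sum integrable_edge_mult integrable_output_msg_0) simp
  finally have I1: "I 1 = I 0 + (\<Sum>c'\<in>{1..n} - {c}. ?J c')" .
  have "0 \<le> (\<Sum>c'\<in>{1..n} - {c}. ?J c')"
    by (intro sum_nonneg mean_output_msg_0_on_edges) simp
  then show "I 0 \<le> I 1"
    using I1 by simp
  assume c: "c \<in> {1..n}" "measure M {x \<in> space M. i \<in> fst x c} > 0"
  \<comment> \<open>A concrete output node other than \<open>c\<close>, which makes the sum nonempty
    and hence strictly positive.\<close>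
  have "(if c = 1 then 2 else 1) \<in> {1..n} - {c}"
    using n_ge_2 by auto
  then have "{1..n} - {c} \<noteq> {}"
    by blast
  then have "0 < (\<Sum>c'\<in>{1..n} - {c}. ?J c')"
    using c by (intro sum_pos mean_output_msg_0_on_edges) auto
  then show "I 0 < I 1"
    using I1 by simp
qed

text \<open>Degrees are at least 1, so every selectable \<open>T\<close> is nonempty; the code in
  which all nodes select \<open>T\<close> has an edge at output node 1.\<close>

lemma ex_edge:
  obtains i c where "i \<in> {1..k}" "c \<in> {1..n}" "measure M {x \<in> space M. i \<in> fst x c} > 0"
proof -
  obtain d where d: "d \<in> set_pmf \<Omega>"
    using set_pmf_not_empty[of \<Omega>] by blast
  obtain T where T: "T \<in> set_pmf (subset_pmf k \<rho> d)"
    using set_pmf_not_empty[of "subset_pmf k \<rho> d"] by blast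
  then have "pmf (subset_pmf k \<rho> d) T \<noteq> 0"
    by (simp add: set_pmf_iff)
  then have "T \<subseteq> {1..k}" "card T = d"
    using pmf_subset_pmf[of k \<rho> d T] selection norm_pos[OF d] by (auto split: if_splits)
  moreover have "d \<ge> 1"
    using d degrees by auto
  ultimately have "T \<noteq> {}"
    by auto
  with \<open>T \<subseteq> {1..k}\<close> obtain i where i: "i \<in> T" "i \<in> {1..k}"
    by blast
  have c: "1 \<in> {1..n}"
    using n_ge_2 by simp
  have "T \<in> set_pmf (bind_pmf \<Omega> (subset_pmf k \<rho>))"
    using T d by auto
  from constant_code_in_set_code_pmf[OF this] have "measure M {x \<in> space M. i \<in> fst x 1} > 0"
    unfolding measure_edge_pos_iff using i c by (intro bexI) simp_all
  with i c show thesis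
    by (intro that)
qed

section \<open>Totals over all edges\<close>

lemma total_over_edges:
  fixes X :: "outcome \<Rightarrow> nat \<Rightarrow> nat \<Rightarrow> real"
  assumes "\<And>i c. integrable M (\<lambda>x. X x i c)"
  shows "(\<integral>x. (\<Sum>(i, c)\<in>edges k n (fst x). X x i c) \<partial>M) =
    (\<Sum>i\<in>{1..k}. \<Sum>c\<in>{1..n}. \<integral>x. of_bool (i \<in> fst x c) * X x i c \<partial>M)"
proof -
  \<comment> \<open>The random edge set becomes an indicator on the fixed grid of node pairs, so sum
    and integral can be exchanged.\<close>
  have "(\<Sum>(i, c)\<in>edges k n (fst x). X x i c) =
      (\<Sum>i\<in>{1..k}. \<Sum>c\<in>{1..n}. of_bool (i \<in> fst x c) * X x i c)" for x
    unfolding sum_edges by (intro sum.cong refl) auto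
  then show ?thesis
    using assms by (simp only: Bochner_Integration.integral_sum Bochner_Integration.integrable_sum
        integrable_edge_mult)
qed

lemma sum_edges_strict_mono:
  fixes f g :: "nat \<Rightarrow> nat \<Rightarrow> real"
  assumes "\<And>i c. f i c \<le> g i c"
    and "\<And>i c. c \<in> {1..n} \<Longrightarrow> measure M {x \<in> space M. i \<in> fst x c} > 0 \<Longrightarrow> f i c < g i c"
  shows "(\<Sum>i\<in>{1..k}. \<Sum>c\<in>{1..n}. f i c) < (\<Sum>i\<in>{1..k}. \<Sum>c\<in>{1..n}. g i c)"
proof -
  obtain i c where ic: "i \<in> {1..k}" "c \<in> {1..n}" "measure M {x \<in> space M. i \<in> fst x c} > 0"
    by (rule ex_edge)
  then have "(\<Sum>c\<in>{1..n}. f i c) < (\<Sum>c\<in>{1..n}. g i c)"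
    using assms by (intro sum_strict_mono_ex1) blast+
  then show ?thesis
    using ic(1) assms(1) by (intro sum_strict_mono_ex1) (auto intro: sum_mono)
qed

text \<open>This is the common denominator of the two edge means. It equals the sum of all adjacency
  probabilities, at least one of which is positive.\<close>

lemma mean_card_edges_pos: "0 < (\<integral>x. real (card (edges k n (fst x))) \<partial>M)"
proof -
  have "(\<integral>x. real (card (edges k n (fst x))) \<partial>M) =
      (\<integral>x. (\<Sum>(i, c)\<in>edges k n (fst x). 1) \<partial>M)"
    by (simp add: case_prod_unfold)
  also have "\<dots> = (\<Sum>i\<in>{1..k}. \<Sum>c\<in>{1..n}. \<integral>x. of_bool (i \<in> fst x c) * 1 \<partial>M)"
    by (rule total_over_edges) simp
  also have "\<dots> = (\<Sum>i\<in>{1..k}. \<Sum>c\<in>{1..n}. measure M {x \<in> space M. i \<in> fst x c})"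
  proof (intro sum.cong refl)
    fix i c
    have "(\<integral>x. of_bool (i \<in> fst x c) * (1 :: real) \<partial>M) =
        (\<integral>x. indicator {x \<in> space M. i \<in> fst x c} x \<partial>M)"
      by (intro Bochner_Integration.integral_cong) (auto simp: indicator_def)
    then show "(\<integral>x. of_bool (i \<in> fst x c) * (1 :: real) \<partial>M) = measure M {x \<in> space M. i \<in> fst x c}"
      by (simp add: Int_absorb2 subset_eq)
  qed
  also have "\<dots> > 0"
    using sum_edges_strict_mono[of "\<lambda>_ _. 0"] by simp
  finally show ?thesis .
qed

text \<open>The denominator does not depend on the round, so it suffices to compare the numerators
  pair by pair.\<close>

lemma edge_mean_increases:
  "edge_mean k n M (\<lambda>x. input_msg k n x 0) < edge_mean k n M (\<lambda>x. input_msg k n x 1)"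
  unfolding edge_mean_def total_over_edges[OF integrable_input_msg_0]
    total_over_edges[OF integrable_input_msg_1]
  by (intro divide_strict_right_mono mean_card_edges_pos sum_edges_strict_mono
      mean_input_msg_1_on_edges)

lemma mean_given_edge_increases:
  assumes "c \<in> {1..n}" "measure M {x \<in> space M. i \<in> fst x c} > 0"
  shows "mean_given_edge M (\<lambda>x. input_msg k n x 0) i c < mean_given_edge M (\<lambda>x. input_msg k n x 1) i c"
  unfolding mean_given_edge_def
  using assms by (intro divide_strict_right_mono mean_input_msg_1_on_edges)

end

theorem theorem1:
  fixes k n :: nat and \<Omega> :: "nat pmf" and \<rho> \<mu> :: "nat \<Rightarrow> real" and s :: real
  assumes "n \<ge> 2"
    and "set_pmf \<Omega> \<subseteq> {1..k}"
    and "\<And>j. j \<in> {1..k} \<Longrightarrow> 0 \<le> \<rho> j \<and> \<rho> j \<le> 1"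
    and "\<And>d. d \<in> set_pmf \<Omega> \<Longrightarrow> subset_norm k \<rho> d > 0"
    and "s > 0"
    and "\<And>i. i \<in> {1..k} \<Longrightarrow> \<bar>\<mu> i\<bar> > 0"
  shows "let M = lt_space k n \<Omega> \<rho> \<mu> s in
    edge_mean k n M (\<lambda>x. input_msg k n x 1) > edge_mean k n M (\<lambda>x. input_msg k n x 0) \<and>
    (\<forall>i\<in>{1..k}. \<forall>c\<in>{1..n}. measure M {x \<in> space M. i \<in> fst x c} > 0 \<longrightarrow>
       mean_given_edge M (\<lambda>x. input_msg k n x 1) i c
       > mean_given_edge M (\<lambda>x. input_msg k n x 0) i c)"
proof -
  interpret lt_code k n \<Omega> \<rho> \<mu> s
    by unfold_locales (fact assms)+
  show ?thesis
    unfolding Let_def using edge_mean_increases mean_given_edge_increases by blast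
qed

end
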